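(* Splitting forcing $\mathbb{SP}$ does not have the weak Sacks property below any condition. That is, for every splitting tree $T$ there are $g \colon \omega \to \omega$ with $g(n) \to \infty$ and an $\mathbb{SP}$-name $\dot x$ for an element of $\omega^\omega$ such that there are no splitting tree $S \subseteq T$, no $a \in [\omega]^\omega$ and no $H \in \prod_{n \in a} [\omega]^{g(n)}$ with $S \Vdash \forall n \in a\, (\dot x(n) \in H(n))$.
   Context: A tree is a set $T \subseteq 2^{<\omega}$ closed under initial segments. For $t \in T$, $T \restriction t = \{ s \in T : s \subseteq t \text{ or } t \subseteq s\}$. For $a \subseteq \omega$ and $X \subseteq 2^{\leq \omega}$, $X$ covers $a$ if for every $n \in a$ and $i \in 2$ there is $s \in X$ with $n \in \operatorname{dom}(s)$ and $s(n) = i$. A tree $T \subseteq 2^{<\omega}$ is a splitting tree if for every $t \in T$, $T \restriction t$ covers a cofinite subset of $\omega$. Splitting forcing $\mathbb{SP}$ is the set of splitting trees ordered by inclusion. A forcing $\mathbb{P}$ has the weak Sacks property if for every $g \colon \omega \to \omega$ with $g(n) \to \infty$, every $p \in \mathbb{P}$ and every name $\dot x$ for an element of $\omega^\omega$ there are $q \leq p$, $a \in [\omega]^\omega$ and $H \in \prod_{n \in a}[\omega]^{g(n)}$ with $q \Vdash \forall n \in a\,(\dot x(n) \in H(n))$. Here $[\omega]^k$ is the set of $k$-element subsets of $\omega$. *)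

theory Defs
  imports Complex_Main "HOL-Library.Sublist" "HOL-Library.FuncSet" "HOL-Library.Ramsey"
begin

section \<open>Splitting trees\<close>

text \<open>Finite binary sequences are lists of Booleans: the domain of \<open>s\<close> is
  \<open>{0..<length s}\<close> and the value of \<open>s\<close> at \<open>n\<close> is \<open>s ! n\<close>.\<close>

definition tree :: "bool list set \<Rightarrow> bool" where
  "tree T \<longleftrightarrow> (\<forall>t\<in>T. \<forall>s. prefix s t \<longrightarrow> s \<in> T)"

definition tree_restrict :: "bool list set \<Rightarrow> bool list \<Rightarrow> bool list set" where
  "tree_restrict T t = {s \<in> T. prefix s t \<or> prefix t s}"

definition covers :: "bool list set \<Rightarrow> nat set \<Rightarrow> bool" where
  "covers X a \<longleftrightarrow> (\<forall>n\<in>a. \<forall>i. \<exists>s\<in>X. n < length s \<and> s ! n = i)"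

text \<open>Nonemptiness is required, as always for tree forcings: the empty set would satisfy
  the remaining clauses vacuously and would be a least condition below all others.\<close>

definition splitting_tree :: "bool list set \<Rightarrow> bool" where
  "splitting_tree T \<longleftrightarrow> T \<noteq> {} \<and> tree T \<and>
     (\<forall>t\<in>T. \<exists>a. finite (- a) \<and> covers (tree_restrict T t) a)"

text \<open>Splitting forcing; the order is the inclusion order of the type \<open>bool list set\<close>.\<close>

definition SP :: "bool list set set" where
  "SP = {T. splitting_tree T}"

section \<open>Names for reals and the forcing relation\<close>

text \<open>A forcing is a set of conditions in a partial order, where \<open>q \<le> p\<close> means that \<open>q\<close> is
  stronger than \<open>p\<close>. A (nice) name for a subset of \<open>\<omega> \<times> \<omega>\<close> is a set of pairs consisting of (the
  canonical name of) a pair of naturals and a condition.\<close>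

type_synonym 'p rel_name = "((nat \<times> nat) \<times> 'p) set"

text \<open>The fragment of the forcing language needed to speak about such names: \<open>Elem k \<tau>\<close> is
  ``\<open>k \<in> \<tau>\<close>'', \<open>Ground b\<close> is an absolute statement \<open>b\<close> about canonical names of ground model
  objects, and \<open>ForallNat\<close> is quantification over the (canonical names of) natural numbers.\<close>

datatype 'p sentence =
    Elem "nat \<times> nat" "'p rel_name"
  | Ground bool
  | Neg "'p sentence"
  | Conj "'p sentence" "'p sentence"
  | ForallNat "nat \<Rightarrow> 'p sentence"

definition Imp :: "'p sentence \<Rightarrow> 'p sentence \<Rightarrow> 'p sentence" where
  "Imp \<phi> \<psi> = Neg (Conj \<phi> (Neg \<psi>))"

definition ExNat :: "(nat \<Rightarrow> 'p sentence) \<Rightarrow> 'p sentence" where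
  "ExNat \<phi> = Neg (ForallNat (\<lambda>n. Neg (\<phi> n)))"

definition dense_below :: "'p::order set \<Rightarrow> 'p \<Rightarrow> 'p set \<Rightarrow> bool" where
  "dense_below P p D \<longleftrightarrow> (\<forall>q\<in>P. q \<le> p \<longrightarrow> (\<exists>r\<in>D. r \<in> P \<and> r \<le> q))"

text \<open>The usual recursive definition of the forcing relation. In the clause for \<open>Elem\<close> we use
  that distinct canonical names are forced to be distinct.\<close>

primrec forces :: "'p::order set \<Rightarrow> 'p \<Rightarrow> 'p sentence \<Rightarrow> bool" where
  "forces P p (Elem k \<tau>) \<longleftrightarrow> dense_below P p {q. \<exists>r. (k, r) \<in> \<tau> \<and> q \<le> r}"
| "forces P p (Ground b) \<longleftrightarrow> b"
| "forces P p (Neg \<phi>) \<longleftrightarrow> (\<forall>q\<in>P. q \<le> p \<longrightarrow> \<not> forces P q \<phi>)"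
| "forces P p (Conj \<phi> \<psi>) \<longleftrightarrow> forces P p \<phi> \<and> forces P p \<psi>"
| "forces P p (ForallNat \<phi>) \<longleftrightarrow> (\<forall>n. forces P p (\<phi> n))"

definition total_sentence :: "'p rel_name \<Rightarrow> 'p sentence" where
  "total_sentence x = ForallNat (\<lambda>n. ExNat (\<lambda>m. Elem (n, m) x))"

definition single_valued_sentence :: "'p rel_name \<Rightarrow> 'p sentence" where
  "single_valued_sentence x =
     ForallNat (\<lambda>n. ForallNat (\<lambda>m. ForallNat (\<lambda>m'. Imp (Conj (Elem (n, m) x) (Elem (n, m') x)) (Ground (m = m')))))"

text \<open>A \<open>P\<close>-name for an element of \<open>\<omega>\<^sup>\<omega>\<close>: every condition forces \<open>x\<close> to be a function
  from \<open>\<omega>\<close> to \<open>\<omega>\<close>.\<close>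

definition baire_name :: "'p::order set \<Rightarrow> 'p rel_name \<Rightarrow> bool" where
  "baire_name P x \<longleftrightarrow> x \<subseteq> UNIV \<times> P \<and>
     (\<forall>p\<in>P. forces P p (Conj (total_sentence x) (single_valued_sentence x)))"

text \<open>The sentence \<open>\<forall>n \<in> a. x(n) \<in> H(n)\<close>, with ground model parameters \<open>a\<close> and \<open>H\<close>.\<close>

definition captured_sentence ::
    "'p rel_name \<Rightarrow> nat set \<Rightarrow> (nat \<Rightarrow> nat set) \<Rightarrow> 'p sentence" where
  "captured_sentence x a H =
     ForallNat (\<lambda>n. Imp (Ground (n \<in> a)) (ExNat (\<lambda>m. Conj (Elem (n, m) x) (Ground (m \<in> H n)))))"

end

theory Submission
  imports Defs "HOL-Library.Countable"
begin

text \<open>Below every splitting tree \<open>T\<close> there is a splitting tree \<open>T'\<close> all of whose splitting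
  subtrees are wide. Choose coordinates \<open>p 0 < p 1 < \<dots>\<close> so sparse that nodes of \<open>T\<close> shorter than
  \<open>p i + 2\<close> can be extended to take either value anywhere from \<open>p (i + 1)\<close> on, cut the indices into
  the blocks \<open>{q\<^sup>2..<(q+1)\<^sup>2}\<close>, and let \<open>T'\<close> consist of the nodes which, in each block, take the
  value 1 at most at two adjacent indices. Allowing two adjacent indices leaves a node
  unconstrained on the whole interval between \<open>p k\<close> and \<open>p (k + 1)\<close>, so \<open>T'\<close> is still splitting.
  A subtree covering a block needs different nodes for \<open>q\<^sup>2, q\<^sup>2 + 2, \<dots>, q\<^sup>2 + 2q\<close>, hence
  has more than \<open>q\<close> nodes at a level depending only on \<open>T'\<close> and \<open>q\<close>. The name \<open>x\<close> is obtained by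
  mixing along a maximal antichain of such trees: below \<open>T'\<close>, \<open>x(q)\<close> codes the node of the generic
  branch at that level.\<close>

section \<open>Extending nodes of splitting trees\<close>

lemma SP_D:
  assumes "S \<in> SP"
  shows "S \<noteq> {}" "tree S" "\<And>t. t \<in> S \<Longrightarrow> \<exists>a. finite (- a) \<and> covers (tree_restrict S t) a"
  using assms by (auto simp: SP_def splitting_tree_def)

lemma SP_prefix: "S \<in> SP \<Longrightarrow> t \<in> S \<Longrightarrow> prefix s t \<Longrightarrow> s \<in> S"
  using SP_D(2) by (auto simp: tree_def)

lemma SP_take: "S \<in> SP \<Longrightarrow> t \<in> S \<Longrightarrow> take n t \<in> S"
  by (meson SP_prefix take_is_prefix)

lemma SP_Nil: "S \<in> SP \<Longrightarrow> [] \<in> S"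
  using SP_D(1) SP_prefix by fastforce

text \<open>For \<open>l\<close> past the finite uncovered set and the length of \<open>t\<close>, a
  node of \<open>tree_restrict S t\<close> defined at \<open>l\<close> must extend \<open>t\<close>;
  truncation then gives it length exactly \<open>Suc l\<close>.\<close>

lemma SP_eventually_extend:
  assumes S: "S \<in> SP" and t: "t \<in> S"
  shows "\<exists>K. \<forall>l\<ge>K. \<forall>v. \<exists>s\<in>S. prefix t s \<and> length s = Suc l \<and> s ! l = v"
proof -
  obtain a where a: "finite (- a)" "covers (tree_restrict S t) a"
    using SP_D(3)[OF S t] by auto
  obtain M where M: "\<forall>n\<in>- a. n < M"
    using a(1) finite_nat_set_iff_bounded by blast
  show ?thesis
  proof (intro exI allI impI)
    fix l v assume l: "max M (length t) \<le> l"
    have "l \<in> a"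
    proof (rule ccontr)
      assume "l \<notin> a"
      then have "l < M" using M by blast
      then show False using l by simp
    qed
    then obtain s where s: "s \<in> tree_restrict S t" "l < length s" "s ! l = v"
      using a(2) unfolding covers_def by metis
    have ps: "prefix t s"
      using s l by (auto simp: tree_restrict_def dest: prefix_length_le)
    have "prefix t (take (Suc l) s)"
      by (rule prefix_length_prefix[OF ps take_is_prefix]) (use s l in auto)
    moreover have "take (Suc l) s \<in> S"
      using SP_take[OF S] s by (auto simp: tree_restrict_def)
    ultimately show "\<exists>s\<in>S. prefix t s \<and> length s = Suc l \<and> s ! l = v"
      using s by (intro bexI[of _ "take (Suc l) s"]) auto
  qed
qed

lemma SP_extend:
  assumes S: "S \<in> SP" and t: "t \<in> S" and l: "length t \<le> l"
  shows "\<exists>s\<in>S. prefix t s \<and> length s = l"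
proof -
  obtain K where K: "\<And>k v. k \<ge> K \<Longrightarrow> \<exists>s\<in>S. prefix t s \<and> length s = Suc k \<and> s ! k = v"
    using SP_eventually_extend[OF S t] by metis
  then obtain s where s: "s \<in> S" "prefix t s" "length s = Suc (max K l)"
    by (metis max.cobounded1)
  have "prefix t (take l s)"
    by (rule prefix_length_prefix[OF s(2) take_is_prefix]) (use s l in auto)
  with s SP_take[OF S s(1), of l] show ?thesis
    by (intro bexI[of _ "take l s"]) auto
qed

text \<open>A node \<open>s\<close> of the restriction and \<open>t\<close> are comparable.
  Everything in \<open>S\<close> above the longer one, \<open>u\<close>, stays in the restriction,
  so covering is inherited from \<open>S\<close> at \<open>u\<close>.\<close>

lemma SP_tree_restrict:
  assumes S: "S \<in> SP" and t: "t \<in> S"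
  shows "tree_restrict S t \<in> SP"
proof -
  have tr: "tree (tree_restrict S t)"
    unfolding tree_def tree_restrict_def
    using SP_prefix[OF S] by (auto intro: prefix_order.trans dest: prefix_same_cases)
  have cov: "\<exists>a. finite (- a) \<and> covers (tree_restrict (tree_restrict S t) s) a"
    if s: "s \<in> tree_restrict S t" for s
  proof -
    define u where "u = (if prefix s t then t else s)"
    have u: "u \<in> S" "prefix t u" "prefix s u"
      using s t by (auto simp: u_def tree_restrict_def)
    obtain K where K: "\<And>l v. l \<ge> K \<Longrightarrow> \<exists>w\<in>S. prefix u w \<and> length w = Suc l \<and> w ! l = v"
      using SP_eventually_extend[OF S u(1)] by metis
    have "covers (tree_restrict (tree_restrict S t) s) {K..}"
      unfolding covers_def
    proof (intro ballI allI)
      fix n v assume "n \<in> {K..}"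
      then obtain w where w: "w \<in> S" "prefix u w" "length w = Suc n" "w ! n = v"
        using K[of n v] by auto
      have "prefix t w" "prefix s w"
        using prefix_order.trans[OF u(2) w(2)] prefix_order.trans[OF u(3) w(2)] by simp_all
      then have "w \<in> tree_restrict (tree_restrict S t) s"
        using w(1) by (simp add: tree_restrict_def)
      with w show "\<exists>s\<in>tree_restrict (tree_restrict S t) s. n < length s \<and> s ! n = v"
        by (intro bexI[of _ w]) auto
    qed
    moreover have "finite (- {K..})" by (simp add: Compl_atLeast)
    ultimately show ?thesis by blast
  qed
  have "t \<in> tree_restrict S t" using t by (simp add: tree_restrict_def)
  then show ?thesis
    using tr cov unfolding SP_def splitting_tree_def by blast
qed

section \<open>Wide trees and the sparse subtree\<close>

text \<open>\<open>L\<close> is fixed before \<open>S\<close>, so that a name can read level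
  \<open>L q\<close> with only \<open>T\<close> known. The bound is eventual because
  \<open>S\<close> covers only a cofinite set.\<close>

definition wide :: "bool list set \<Rightarrow> (nat \<Rightarrow> nat) \<Rightarrow> bool" where
  "wide T L \<longleftrightarrow> (\<forall>S\<in>SP. S \<subseteq> T \<longrightarrow> (\<forall>\<^sub>F q in sequentially. q < card {s \<in> S. length s = L q}))"

definition sparse_ones :: "(nat \<Rightarrow> nat) \<Rightarrow> bool list \<Rightarrow> bool" where
  "sparse_ones p u \<longleftrightarrow> (\<forall>q i j. q * q \<le> i \<longrightarrow> i + 2 \<le> j \<longrightarrow> j < Suc q * Suc q \<longrightarrow>
      p j < length u \<longrightarrow> \<not> (u ! p i \<and> u ! p j))"

lemma nth_prefix: "prefix s u \<Longrightarrow> n < length s \<Longrightarrow> u ! n = s ! n"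
  by (auto simp: prefix_def nth_append)

locale sparse_coordinates =
  fixes T :: "bool list set" and p :: "nat \<Rightarrow> nat"
  assumes T: "T \<in> SP" and p: "strict_mono p"
    and extend: "\<And>i w l v. w \<in> T \<Longrightarrow> length w \<le> Suc (p i) \<Longrightarrow> p (Suc i) \<le> l \<Longrightarrow>
      \<exists>s\<in>T. prefix w s \<and> length s = Suc l \<and> s ! l = v"
begin

lemma p_less [simp]: "p i < p j \<longleftrightarrow> i < j"
  by (rule strict_mono_less[OF p])

lemma p_le [simp]: "p i \<le> p j \<longleftrightarrow> i \<le> j"
  by (rule strict_mono_less_eq[OF p])

lemma sparse_ones_prefix:
  assumes "sparse_ones p u" "prefix s u"
  shows "sparse_ones p s"
  unfolding sparse_ones_def
proof (intro allI impI)
  fix q i j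
  assume h: "q * q \<le> i" "i + 2 \<le> j" "j < Suc q * Suc q" "p j < length s"
  moreover have "p i < p j" using h by simp
  ultimately have "p i < length s" "p j < length u"
    using prefix_length_le[OF assms(2)] by linarith+
  with h assms show "\<not> (s ! p i \<and> s ! p j)"
    unfolding sparse_ones_def by (metis nth_prefix)
qed

text \<open>Only nodes with a sparse extension ending just after some coordinate are kept. Other
  sparse nodes could be dead ends: one longer than \<open>Suc (p i)\<close> may be forced by
  \<open>T\<close> to take the value 1 at \<open>p (Suc i)\<close>.\<close>

definition subtree :: "bool list set" where
  "subtree = {s. \<exists>u i. u \<in> T \<and> sparse_ones p u \<and> length u = Suc (p i) \<and> prefix s u}"

lemma subtree_sparse_ones: "s \<in> subtree \<Longrightarrow> sparse_ones p s"
  using sparse_ones_prefix by (auto simp: subtree_def)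

text \<open>A new zero never breaks sparseness, and \<open>extend\<close> allows it at the next
  coordinate because the current node ends just after the previous one.\<close>

lemma extend_zeros:
  assumes "u \<in> T" "sparse_ones p u" "length u = Suc (p i)"
  shows "\<exists>w\<in>T. sparse_ones p w \<and> prefix u w \<and> length w = Suc (p (i + k)) \<and>
           (\<forall>j. i < j \<longrightarrow> j \<le> i + k \<longrightarrow> \<not> w ! p j)"
proof (induction k)
  case 0
  then show ?case using assms by auto
next
  case (Suc k)
  then obtain w where w: "w \<in> T" "sparse_ones p w" "prefix u w" "length w = Suc (p (i + k))"
    "\<And>j. i < j \<Longrightarrow> j \<le> i + k \<Longrightarrow> \<not> w ! p j" by auto
  obtain s where s: "s \<in> T" "prefix w s" "length s = Suc (p (Suc (i + k)))"
    "\<not> s ! p (Suc (i + k))"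
    using extend[OF w(1), of "i + k" "p (Suc (i + k))" False] w(4) by auto
  have nth: "s ! p j = w ! p j" if "j \<le> i + k" for j
    using nth_prefix[OF s(2), of "p j"] that w(4) by (simp add: less_Suc_eq_le)
  have "sparse_ones p s"
    unfolding sparse_ones_def
  proof (intro allI impI)
    fix q a b
    assume h: "q * q \<le> a" "a + 2 \<le> b" "b < Suc q * Suc q" "p b < length s"
    have "b \<le> Suc (i + k)" using h(4) s(3) by (simp add: less_Suc_eq_le)
    show "\<not> (s ! p a \<and> s ! p b)"
    proof (cases "b = Suc (i + k)")
      case True then show ?thesis using s(4) by simp
    next
      case False
      then have "b \<le> i + k" "a \<le> i + k" using \<open>b \<le> Suc (i + k)\<close> h by auto
      then show ?thesis
        using w(2,4) h nth unfolding sparse_ones_def by (simp add: less_Suc_eq_le)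
    qed
  qed
  moreover have "\<not> s ! p j" if "i < j" "j \<le> i + Suc k" for j
    using that nth[of j] w(5)[of j] s(4) by (cases "j = Suc (i + k)") auto
  moreover have "prefix u s" using w(3) s(2) by (rule prefix_order.trans)
  ultimately show ?case using s by auto
qed

lemma subtree_subset: "subtree \<subseteq> T"
  using SP_prefix[OF T] by (auto simp: subtree_def)

text \<open>Let \<open>l\<close> lie between \<open>p k\<close> and \<open>p (Suc k)\<close>. Zeros
  are taken at the indices after \<open>i\<close> and before \<open>k\<close>. Prescribing the value
  at \<open>l\<close> gives up control at \<open>k\<close>, and completing the interval gives it up
  at \<open>Suc k\<close>. These two indices are adjacent, and both lie in later blocks than any
  index up to \<open>i\<close>.\<close>

lemma subtree_cover:
  assumes u: "u \<in> T" "sparse_ones p u" "length u = Suc (p i)"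
    and l: "p (Suc i * Suc i) \<le> l"
  shows "\<exists>w\<in>subtree. prefix u w \<and> l < length w \<and> w ! l = v"
proof -
  have "\<exists>k. p (Suc i * Suc i) \<le> p k \<and> p k \<le> l \<and> l < p (Suc k)"
  proof -
    have ub: "l < p (Suc l)" using strict_mono_imp_increasing[OF p, of "Suc l"] by linarith
    define k where "k = (LEAST k. l < p (Suc k))"
    have k: "l < p (Suc k)" unfolding k_def by (rule LeastI[of _ l]) (rule ub)
    have "Suc i * Suc i \<le> k"
    proof -
      have "p (Suc i * Suc i) < p (Suc k)" using l k by linarith
      then show ?thesis unfolding p_less by linarith
    qed
    moreover have "p k \<le> l"
    proof (cases k)
      case 0 then show ?thesis using \<open>Suc i * Suc i \<le> k\<close> by simp
    next
      case (Suc k')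
      then show ?thesis
        using not_less_Least[of k' "\<lambda>k. l < p (Suc k)"] k_def by auto
    qed
    ultimately show ?thesis using k p_le by blast
  qed
  then obtain k where "p (Suc i * Suc i) \<le> p k" and k: "p k \<le> l" "l < p (Suc k)" by blast
  then have ik: "Suc i * Suc i \<le> k" by simp
  then have "i < k" by auto
  then obtain d where d: "k = Suc (i + d)" using less_imp_Suc_add by blast
  obtain u' where u': "u' \<in> T" "sparse_ones p u'" "prefix u u'" "length u' = Suc (p (i + d))"
    "\<And>j. i < j \<Longrightarrow> j \<le> i + d \<Longrightarrow> \<not> u' ! p j"
    using extend_zeros[OF u, of d] by auto
  obtain s where s: "s \<in> T" "prefix u' s" "length s = Suc l" "s ! l = v"
    using extend[OF u'(1), of "i + d" l v] u'(4) k d by auto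
  obtain w where w: "w \<in> T" "prefix s w" "length w = Suc (p (Suc k))"
    using SP_extend[OF T s(1), of "Suc (p (Suc k))"] s(3) k by auto
  have u'w: "prefix u' w" using s(2) w(2) by (rule prefix_order.trans)
  have nth: "w ! p j = u' ! p j" if "j \<le> i + d" for j
    using nth_prefix[OF u'w, of "p j"] that u'(4) by (simp add: less_Suc_eq_le)
  have "sparse_ones p w"
    unfolding sparse_ones_def
  proof (intro allI impI)
    fix q a b
    assume h: "q * q \<le> a" "a + 2 \<le> b" "b < Suc q * Suc q" "p b < length w"
    have b: "b \<le> Suc k" using h(4) w(3) by (simp add: less_Suc_eq_le)
    then have a: "a \<le> i + d" using h d by simp
    show "\<not> (w ! p a \<and> w ! p b)"
    proof (cases "b \<le> i + d")
      case True
      then show ?thesis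
        using u'(2,4) h nth a unfolding sparse_ones_def by (simp add: less_Suc_eq_le)
    next
      case False
      then have "k \<le> b" using d by simp
      \<comment> \<open>If \<open>a \<le> i\<close>, then \<open>q \<le> i\<close>, so block
        \<open>q\<close> ends before \<open>Suc i * Suc i\<close> and hence before
        \<open>k\<close>.\<close>
      have "i < a"
      proof (rule ccontr)
        assume "\<not> i < a"
        then have "q \<le> i" using h(1) le_square[of q] by linarith
        then have "Suc q * Suc q \<le> Suc i * Suc i" by (intro mult_le_mono) auto
        then show False using h(3) \<open>k \<le> b\<close> ik by linarith
      qed
      then show ?thesis using u'(5) a nth by auto
    qed
  qed
  then have "w \<in> subtree" using w by (auto simp: subtree_def)
  moreover have "prefix u w" using u'(3) u'w by (rule prefix_order.trans)
  moreover have "l < length w" "w ! l = v"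
    using nth_prefix[OF w(2), of l] s prefix_length_le[OF w(2)] by auto
  ultimately show ?thesis by blast
qed

lemma subtree_SP: "subtree \<in> SP"
proof -
  have "tree subtree"
    by (auto simp: tree_def subtree_def intro: prefix_order.trans)
  moreover have "subtree \<noteq> {}"
  proof -
    obtain u where u: "u \<in> T" "length u = Suc (p 0)"
      using SP_extend[OF T SP_Nil[OF T], of "Suc (p 0)"] by auto
    \<comment> \<open>Only the coordinate \<open>p 0\<close> lies inside \<open>u\<close>, so no
      pair of indices is constrained.\<close>
    have "sparse_ones p u"
      using u(2) by (auto simp: sparse_ones_def less_Suc_eq_le)
    then show ?thesis using u by (auto simp: subtree_def)
  qed
  moreover have "\<exists>a. finite (- a) \<and> covers (tree_restrict subtree s) a" if "s \<in> subtree" for s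
  proof -
    obtain u i where u: "u \<in> T" "sparse_ones p u" "length u = Suc (p i)" "prefix s u"
      using \<open>s \<in> subtree\<close> by (auto simp: subtree_def)
    have "covers (tree_restrict subtree s) {p (Suc i * Suc i)..}"
      unfolding covers_def
    proof (intro ballI allI)
      fix l v assume "l \<in> {p (Suc i * Suc i)..}"
      then obtain w where "w \<in> subtree" "prefix u w" "l < length w" "w ! l = v"
        using subtree_cover[OF u(1-3), of l v] by auto
      with u(4) show "\<exists>s\<in>tree_restrict subtree s. l < length s \<and> s ! l = v"
        by (auto simp: tree_restrict_def intro: prefix_order.trans)
    qed
    moreover have "finite (- {p (Suc i * Suc i)..})" by (simp add: Compl_atLeast)
    ultimately show ?thesis by blast
  qed
  ultimately show ?thesis by (simp add: SP_def splitting_tree_def)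
qed

lemma wide_subtree: "wide subtree (\<lambda>q. Suc (p (Suc q * Suc q)))"
  unfolding wide_def
proof (intro ballI impI)
  fix S assume S: "S \<in> SP" and sub: "S \<subseteq> subtree"
  obtain K where K: "\<And>l v. l \<ge> K \<Longrightarrow> \<exists>s\<in>S. prefix [] s \<and> length s = Suc l \<and> s ! l = v"
    using SP_eventually_extend[OF S SP_Nil[OF S]] by metis
  have "q < card {s \<in> S. length s = Suc (p (Suc q * Suc q))}" if q: "q \<ge> K" for q
  proof -
    \<comment> \<open>For \<open>j \<le> q\<close> the indices \<open>q * q + 2 * j\<close> are
      \<open>Suc q\<close> pairwise nonadjacent members of block \<open>q\<close>, the last one
      being the end of the block.\<close>
    let ?L = "Suc (p (Suc q * Suc q))" and ?e = "\<lambda>j. p (q * q + 2 * j)"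
    have e: "?e j < ?L" if "j \<le> q" for j
      using that by (simp add: less_Suc_eq_le)
    have "\<exists>s\<in>S. length s = ?L \<and> s ! ?e j" if j: "j \<le> q" for j
    proof -
      \<comment> \<open>Here \<open>K \<le> q \<le> q * q\<close>, and an increasing
        \<open>p\<close> dominates the identity.\<close>
      have "K \<le> ?e j"
        using q le_square[of q] strict_mono_imp_increasing[OF p, of "q * q + 2 * j"] by linarith
      then obtain s where s: "s \<in> S" "length s = Suc (?e j)" "s ! ?e j"
        using K[of "?e j" True] by auto
      have "length s \<le> ?L" using s(2) e[OF j] by linarith
      then obtain w where w: "w \<in> S" "prefix s w" "length w = ?L"
        using SP_extend[OF S s(1)] by blast
      then show ?thesis using nth_prefix[OF w(2), of "?e j"] s by auto
    qed
    then obtain f where f: "\<And>j. j \<le> q \<Longrightarrow> f j \<in> S \<and> length (f j) = ?L \<and> f j ! ?e j"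
      by metis
    have neq: "f i \<noteq> f j" if "i < j" "j \<le> q" for i j
    proof
      assume "f i = f j"
      then have "f j ! ?e i" "f j ! ?e j" using f[of i] f[of j] that by auto
      moreover have "sparse_ones p (f j)"
        using f[of j] that sub subtree_sparse_ones by auto
      moreover have "q * q + 2 * j < Suc q * Suc q" using that by simp
      moreover have "q * q + 2 * i + 2 \<le> q * q + 2 * j" "?e j < length (f j)"
        using f[of j] e[of j] that by auto
      ultimately show False
        unfolding sparse_ones_def using le_add1 by blast
    qed
    have "inj_on f {..q}"
      unfolding inj_on_def by (metis atMost_iff neq linorder_neqE_nat)
    then have "card (f ` {..q}) = Suc q" by (simp add: card_image)
    moreover have "f ` {..q} \<subseteq> {s \<in> S. length s = ?L}" using f by auto
    moreover have "finite {s \<in> S. length s = ?L}"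
      by (rule finite_subset[OF _ finite_lists_length_eq[OF finite_UNIV]]) auto
    ultimately show ?thesis by (metis card_mono Suc_le_eq)
  qed
  then show "\<forall>\<^sub>F q in sequentially. q < card {s \<in> S. length s = Suc (p (Suc q * Suc q))}"
    by (rule eventually_sequentiallyI)
qed

end

section \<open>Density of wide trees\<close>

lemma wide_dense:
  assumes T: "T \<in> SP"
  shows "\<exists>S\<in>SP. S \<subseteq> T \<and> (\<exists>L. wide S L)"
proof -
  \<comment> \<open>There are only finitely many nodes of length at most \<open>N\<close>, so their
    thresholds have a common bound.\<close>
  have "\<exists>K. \<forall>w\<in>T. length w \<le> N \<longrightarrow>
      (\<forall>l\<ge>K. \<forall>v. \<exists>s\<in>T. prefix w s \<and> length s = Suc l \<and> s ! l = v)" for N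
  proof -
    let ?W = "{w \<in> T. length w \<le> N}"
    obtain k where k: "\<And>w l v. w \<in> T \<Longrightarrow> l \<ge> k w \<Longrightarrow>
        \<exists>s\<in>T. prefix w s \<and> length s = Suc l \<and> s ! l = v"
      using SP_eventually_extend[OF T] by metis
    have "finite ?W"
      by (rule finite_subset[OF _ finite_lists_length_le[OF finite_UNIV, of N]]) auto
    then have "k w \<le> Max (k ` ?W)" if "w \<in> ?W" for w using that by simp
    then show ?thesis by (intro exI[of _ "Max (k ` ?W)"]) (auto intro!: k intro: order_trans)
  qed
  then obtain K where K: "\<And>N w l v. w \<in> T \<Longrightarrow> length w \<le> N \<Longrightarrow> K N \<le> l \<Longrightarrow>
      \<exists>s\<in>T. prefix w s \<and> length s = Suc l \<and> s ! l = v"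
    by metis
  \<comment> \<open>\<open>K (Suc (p i))\<close> serves the assumption \<open>extend\<close>; the
    other term makes \<open>p\<close> strictly increasing.\<close>
  define p where "p = rec_nat 0 (\<lambda>_ n. max (K (Suc n)) (Suc n))"
  have p_Suc: "p (Suc i) = max (K (Suc (p i))) (Suc (p i))" for i by (simp add: p_def)
  interpret sparse_coordinates T p
  proof
    show "strict_mono p" by (simp add: strict_mono_Suc_iff p_Suc less_max_iff_disj)
  qed (use T K p_Suc in auto)
  show ?thesis using subtree_SP subtree_subset wide_subtree by blast
qed

section \<open>Maximal antichains and forced membership\<close>

text \<open>Zorn's lemma gives a maximal antichain inside \<open>D\<close>. If some \<open>q\<close>
  were incompatible with all its members, an element of \<open>D\<close> below \<open>q\<close>
  could be added.\<close>

lemma maximal_antichain_in_dense_set_exists: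
  fixes P D :: "'p::order set"
  assumes D: "D \<subseteq> P" and dense: "\<And>q. q \<in> P \<Longrightarrow> \<exists>d\<in>D. d \<le> q"
  shows "\<exists>A\<subseteq>D. (\<forall>a\<in>A. \<forall>b\<in>A. \<forall>r\<in>P. r \<le> a \<longrightarrow> r \<le> b \<longrightarrow> a = b) \<and>
    (\<forall>q\<in>P. \<exists>a\<in>A. \<exists>r\<in>P. r \<le> a \<and> r \<le> q)"
proof -
  define anti where "anti A \<longleftrightarrow> A \<subseteq> D \<and> (\<forall>a\<in>A. \<forall>b\<in>A. \<forall>r\<in>P. r \<le> a \<longrightarrow> r \<le> b \<longrightarrow> a = b)" for A
  have "\<exists>M\<in>Collect anti. \<forall>X\<in>Collect anti. M \<subseteq> X \<longrightarrow> X = M"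
  proof (rule subset_Zorn_nonempty)
    show "Collect anti \<noteq> {}" by (auto simp: anti_def intro!: exI[of _ "{}"])
  next
    fix C assume C: "C \<noteq> {}" "subset.chain (Collect anti) C"
    have "a = b" if "a \<in> X" "X \<in> C" "b \<in> Y" "Y \<in> C" "r \<in> P" "r \<le> a" "r \<le> b" for a b r X Y
    proof -
      have "X \<subseteq> Y \<or> Y \<subseteq> X" using C(2) that by (auto simp: subset_chain_def)
      moreover have "anti X" "anti Y" using C(2) that by (auto simp: subset_chain_def)
      ultimately show ?thesis using that unfolding anti_def by (meson subsetD)
    qed
    moreover have "\<Union>C \<subseteq> D" using C(2) unfolding subset_chain_def anti_def by blast
    ultimately show "\<Union>C \<in> Collect anti" unfolding mem_Collect_eq anti_def by blast
  qed
  then obtain M where M: "anti M" and max: "\<And>X. anti X \<Longrightarrow> M \<subseteq> X \<Longrightarrow> X = M" by auto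
  have "\<forall>q\<in>P. \<exists>a\<in>M. \<exists>r\<in>P. r \<le> a \<and> r \<le> q"
  proof (intro ballI, rule ccontr)
    fix q assume "q \<in> P"
    assume no: "\<not> (\<exists>a\<in>M. \<exists>r\<in>P. r \<le> a \<and> r \<le> q)"
    obtain d where d: "d \<in> D" "d \<le> q" using dense[OF \<open>q \<in> P\<close>] by blast
    have "anti (insert d M)"
      using M no d unfolding anti_def by (auto intro: order_trans)
    then have "insert d M = M" by (rule max) auto
    then have "d \<in> M" by auto
    with no d D show False by blast
  qed
  moreover have "M \<subseteq> D" "\<forall>a\<in>M. \<forall>b\<in>M. \<forall>r\<in>P. r \<le> a \<longrightarrow> r \<le> b \<longrightarrow> a = b"
    using M by (simp_all add: anti_def)
  ultimately show ?thesis by (intro exI[of _ M] conjI)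
qed

lemma forces_Elem_I:
  assumes "(k, r) \<in> \<tau>" "p \<le> r"
  shows "forces P p (Elem k \<tau>)"
  using assms by (auto simp: dense_below_def intro: order_trans)

lemma forces_Elem_D:
  assumes "forces P p (Elem k \<tau>)" "q \<in> P" "q \<le> p"
  obtains r s where "(k, r) \<in> \<tau>" "s \<in> P" "s \<le> q" "s \<le> r"
  using assms by (auto simp: dense_below_def)

section \<open>The mixed name and the failure of capture\<close>

theorem theorem2p8:
  fixes T :: "bool list set"
  assumes "T \<in> SP"
  shows "\<exists>(g :: nat \<Rightarrow> nat) (x :: bool list set rel_name).
           filterlim g at_top sequentially \<and> baire_name SP x \<and>
           \<not> (\<exists>S (a :: nat set) H.
                 S \<in> SP \<and> S \<subseteq> T \<and> infinite a \<and>
                 H \<in> (\<Pi>\<^sub>E n\<in>a. nsets (UNIV :: nat set) (g n)) \<and>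
                 forces SP S (captured_sentence x a H))"
proof -
  let ?D = "{S \<in> SP. \<exists>L. wide S L}"
  have "\<exists>A\<subseteq>?D. (\<forall>a\<in>A. \<forall>b\<in>A. \<forall>r\<in>SP. r \<subseteq> a \<longrightarrow> r \<subseteq> b \<longrightarrow> a = b) \<and>
      (\<forall>q\<in>SP. \<exists>a\<in>A. \<exists>r\<in>SP. r \<subseteq> a \<and> r \<subseteq> q)"
    by (rule maximal_antichain_in_dense_set_exists) (use wide_dense in blast)+
  then obtain A where A: "A \<subseteq> ?D"
    and eq: "\<forall>a\<in>A. \<forall>b\<in>A. \<forall>r\<in>SP. r \<subseteq> a \<longrightarrow> r \<subseteq> b \<longrightarrow> a = b"
    and max: "\<forall>q\<in>SP. \<exists>a\<in>A. \<exists>r\<in>SP. r \<subseteq> a \<and> r \<subseteq> q"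
    by (elim exE conjE) (rule that)
  have A_eq: "a = b" if "a \<in> A" "b \<in> A" "r \<in> SP" "r \<subseteq> a" "r \<subseteq> b" for a b r
    using eq[rule_format, OF that] .
  have A_max: "\<exists>a\<in>A. \<exists>r\<in>SP. r \<subseteq> a \<and> r \<subseteq> q" if "q \<in> SP" for q
    using max[rule_format, OF that] .
  obtain L where L: "\<And>U. U \<in> A \<Longrightarrow> wide U (L U)"
  proof -
    have "\<forall>U\<in>A. \<exists>L. wide U L" using A by blast
    then show thesis using that by metis
  qed
  \<comment> \<open>A condition \<open>R\<close> below \<open>U\<close> contributes a value at
    \<open>n\<close> when it has a single node at level \<open>L U n\<close>; the value is the code
    of that node. The universal quantifier is never vacuous, since \<open>R\<close> has nodes of
    every length.\<close>
  define x :: "bool list set rel_name" where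
    "x = {((n, m), R). R \<in> SP \<and> (\<exists>U\<in>A. R \<subseteq> U \<and> (\<forall>s\<in>R. length s = L U n \<longrightarrow> to_nat s = m))}"
  have level: "\<exists>s\<in>R. length s = l" if "R \<in> SP" for R l
    using SP_extend[OF that SP_Nil[OF that]] by auto
  have restrict: "R = s" if "R \<in> tree_restrict S s" "length R = length s" for R s S
    using that by (auto simp: tree_restrict_def prefix_def)
  \<comment> \<open>The antichain member witnessing that \<open>R\<close> contributes
    \<open>m\<close> has the common extension \<open>S\<close> with \<open>U\<close>, so it is
    \<open>U\<close>, and \<open>R\<close> decides the level \<open>L U n\<close>.\<close>
  have x_unique: "m = to_nat s"
    if "((n, m), R) \<in> x" "S \<in> SP" "S \<subseteq> R" "S \<subseteq> U" "U \<in> A" "s \<in> S" "length s = L U n"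
    for n m R S U s
  proof -
    obtain V where V: "V \<in> A" "R \<subseteq> V" "\<forall>s\<in>R. length s = L V n \<longrightarrow> to_nat s = m"
      using \<open>((n, m), R) \<in> x\<close> by (auto simp: x_def)
    then have "V = U" using A_eq[of V U S] that by auto
    then show ?thesis using V that by auto
  qed
  have total: "\<exists>m. \<exists>R\<in>SP. R \<subseteq> q \<and> ((n, m), R) \<in> x" if q: "q \<in> SP" for q n
  proof -
    obtain U S where U: "U \<in> A" "S \<in> SP" "S \<subseteq> U" "S \<subseteq> q" using A_max[OF q] by blast
    obtain s where s: "s \<in> S" "length s = L U n" using level[OF U(2)] by blast
    have R: "tree_restrict S s \<in> SP" by (rule SP_tree_restrict[OF U(2) s(1)])
    have sub: "tree_restrict S s \<subseteq> S" by (auto simp: tree_restrict_def)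
    have "\<forall>r\<in>tree_restrict S s. length r = L U n \<longrightarrow> to_nat r = to_nat s"
      using restrict[of _ S s] s(2) by metis
    moreover have "tree_restrict S s \<subseteq> U" using sub U(3) by (rule order_trans)
    ultimately have "((n, to_nat s), tree_restrict S s) \<in> x"
      unfolding x_def using R U(1) by blast
    moreover have "tree_restrict S s \<subseteq> q" using sub U(4) by (rule order_trans)
    ultimately show ?thesis using R by blast
  qed
  have "baire_name SP x"
    unfolding baire_name_def
  proof (intro conjI ballI)
    show "x \<subseteq> UNIV \<times> SP" by (auto simp: x_def)
    fix p :: "bool list set" assume p: "p \<in> SP"
    have "\<exists>m. \<exists>R\<in>SP. R \<le> q \<and> forces SP R (Elem (n, m) x)" if "q \<in> SP" for q n
      using total[OF that, of n] forces_Elem_I[where P=SP] by blast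
    then have t: "forces SP p (total_sentence x)"
      by (auto simp: total_sentence_def ExNat_def simp del: forces.simps(1))
    have "m = m'" if q: "q \<in> SP" and f: "forces SP q (Elem (n, m) x)" "forces SP q (Elem (n, m') x)"
      for q n m m'
    proof -
      obtain R S where R: "((n, m), R) \<in> x" "S \<in> SP" "S \<subseteq> q" "S \<subseteq> R"
        using forces_Elem_D[OF f(1) q] by blast
      \<comment> \<open>The second extension is chosen below the first, so that \<open>S'\<close>
        lies below both contributing conditions.\<close>
      obtain R' S' where R': "((n, m'), R') \<in> x" "S' \<in> SP" "S' \<subseteq> S" "S' \<subseteq> R'"
        using forces_Elem_D[OF f(2) R(2,3)] by blast
      obtain U where U: "U \<in> A" "R \<subseteq> U" using R(1) by (auto simp: x_def)
      obtain s where s: "s \<in> S'" "length s = L U n" using level[OF R'(2)] by blast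
      have sub: "S' \<subseteq> R" "S' \<subseteq> U" using R R' U by auto
      show ?thesis
        using x_unique[OF R(1) R'(2) sub U(1) s] x_unique[OF R'(1) R'(2) R'(4) sub(2) U(1) s]
        by simp
    qed
    then have "forces SP p (single_valued_sentence x)"
      by (fastforce simp: single_valued_sentence_def Imp_def simp del: forces.simps(1))
    with t show "forces SP p (Conj (total_sentence x) (single_valued_sentence x))" by simp
  qed
  moreover have False
    if S: "S \<in> SP" and a: "infinite a" and H: "H \<in> (\<Pi>\<^sub>E n\<in>a. nsets (UNIV :: nat set) n)"
      and f: "forces SP S (captured_sentence x a H)" for S a H
  proof -
    have cap: "\<exists>m\<in>H n. \<exists>r\<in>SP. r \<subseteq> q \<and> forces SP r (Elem (n, m) x)"
      if n: "n \<in> a" and q: "q \<in> SP" "q \<subseteq> S" for n q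
      using f n q
      by (simp add: captured_sentence_def Imp_def ExNat_def del: forces.simps(1)) (meson order_trans order_refl)
    \<comment> \<open>Inside one member of the antichain the level read by \<open>x\<close> is
      known, and width applies to \<open>S'\<close>.\<close>
    obtain U S' where U: "U \<in> A" "S' \<in> SP" "S' \<subseteq> U" "S' \<subseteq> S" using A_max[OF S] by blast
    have "\<forall>\<^sub>F n in sequentially. n < card {s \<in> S'. length s = L U n}"
      using L[OF U(1)] U unfolding wide_def by blast
    then obtain n where n: "n \<in> a" "n < card {s \<in> S'. length s = L U n}"
      using a unfolding eventually_sequentially infinite_nat_iff_unbounded_le by blast
    \<comment> \<open>Every node of the level is a possible value of the generic branch: restricting
      \<open>S'\<close> to \<open>s\<close> forces the value at \<open>n\<close> to be the code of
      \<open>s\<close>, which capture puts into \<open>H n\<close>.\<close>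
    have "to_nat s \<in> H n" if s: "s \<in> S'" "length s = L U n" for s
    proof -
      have sub: "tree_restrict S' s \<subseteq> S'" by (auto simp: tree_restrict_def)
      obtain m r where m: "m \<in> H n" "r \<in> SP" "r \<subseteq> tree_restrict S' s" "forces SP r (Elem (n, m) x)"
        using cap[OF n(1) SP_tree_restrict[OF U(2) s(1)]] sub U by blast
      obtain R r' where R: "((n, m), R) \<in> x" "r' \<in> SP" "r' \<subseteq> r" "r' \<subseteq> R"
        using forces_Elem_D[OF m(4,2)] by blast
      obtain t where t: "t \<in> r'" "length t = L U n" using level[OF R(2)] by blast
      then have "t = s" using restrict[of t S' s] s m R by auto
      moreover have "m = to_nat t"
        using x_unique[OF R(1,2,4) _ U(1) t] R m sub U by blast
      ultimately show ?thesis using m by simp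
    qed
    then have "to_nat ` {s \<in> S'. length s = L U n} \<subseteq> H n" by auto
    moreover have "finite (H n)" "card (H n) = n"
      using H n(1) by (auto simp: PiE_def Pi_def nsets_def)
    ultimately have "card {s \<in> S'. length s = L U n} \<le> n"
      using card_mono card_image[OF inj_on_subset[OF inj_to_nat subset_UNIV]] by metis
    with n show False by simp
  qed
  ultimately show ?thesis
    \<comment> \<open>The identity serves as \<open>g\<close>, since eventually level
      \<open>L U n\<close> has more than \<open>n\<close> nodes.\<close>
    by (intro exI[of _ "\<lambda>n. n"] exI[of _ x]) (auto simp: filterlim_ident)
qed

end
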